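(* Let $L_n$ be the filiform Lie algebra defined by the basis $\{e_1,e_2,\ldots,e_n\}$ and the Lie brackets $$\mu(e_1,e_2)=e_3,\quad \mu(e_1,e_3)=e_4,\quad\ldots,\quad \mu(e_1,e_{n-1})=e_n.$$ For $D:=\mathrm{Diag}(d_1,d_2,d_1+d_2,2d_1+d_2,\ldots,(n-2)d_1+d_2)\in\mathfrak{t}(L_n)$, the cone $\mathcal{C}(L_n)$ is defined by the following inequalities: $$(n-2)d_1+d_2>0\qquad\text{and}\qquad \frac{(n-1)(n-2)}{2}d_1+(n-1)d_2>0,$$ that is, $D\in\mathcal{C}(L_n)$ if and only if both inequalities hold.
   Context: Let $\mathfrak{n}$ be a real nilpotent Lie algebra of dimension $N$ with Lie bracket $[\cdot,\cdot]$. $\mathfrak{t}(\mathfrak{n})$ denotes a maximal abelian subspace of derivations of $\mathfrak{n}$ diagonalizable over $\mathbb{R}$ (a maximal torus). Fix a basis $\{e_1,\dots,e_N\}$ of $\mathfrak{n}$ such that $\mathfrak{t}(\mathfrak{n})\subset \mathrm{Diag}(\mathfrak{n})$, the space of operators of $\mathfrak{n}$ that are diagonal in this basis; $\mathrm{Diag}(\mathfrak{n})_{>0}$ denotes the diagonal operators with all diagonal entries positive. Put $\mathfrak{t}(\mathfrak{n})_{\mathrm{tr}>0}=\{D\in\mathfrak{t}(\mathfrak{n}):\mathrm{tr}\,D>0\}$. For $L_n$ the basis is the one given in the claim, and $\mathfrak{t}(L_n)$ is the set of all $D$ of the displayed form with $d_1,d_2\in\mathbb{R}$. $\mathrm{GL}(\mathfrak{n})$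 acts on $V=\Lambda^2\mathfrak{n}^*\otimes\mathfrak{n}$ by $g\cdot\mu=g\mu(g^{-1}\cdot,g^{-1}\cdot)$, with derivative $E\cdot\mu=E\mu(\cdot,\cdot)-\mu(E\cdot,\cdot)-\mu(\cdot,E\cdot)$ for $E\in\mathfrak{gl}(\mathfrak{n})$. Endow $\mathfrak{gl}(\mathfrak{n})$ and $V$ with the inner products making $\{e_i\otimes e^j\}$ and $\{(e^i\wedge e^j)\otimes e_k: i<j\}$ orthonormal. The moment map $\mathrm{m}:V\setminus\{0\}\to\mathrm{sym}(\mathfrak{n})$ (operators symmetric with respect to the inner product making $\{e_i\}$ orthonormal) is defined by $\langle \mathrm{m}(\mu),E\rangle=\frac{1}{|\mu|^2}\langle E\cdot\mu,\mu\rangle$ for all $E\in\mathrm{sym}(\mathfrak{n})$. For a subset $S\subset V$, $\mathrm{m}(S)$ denotes the set of all $\mathrm{m}(\lambda)$ with $\lambda\in S$, $\lambda\neq 0$. Let $G_{\mathfrak{t}(\mathfrak{n})}$ be the connected component of the identity of the centralizer of $\mathfrak{t}(\mathfrak{n})$ in $\mathrm{GL}(\mathfrak{n})$. Then $$\mathcal{C}(\mathfrak{n}):=\left(\mathbb{R}_{>0}\,\mathrm{m}\left(\overline{G_{\mathfrak{t}(\mathfrak{n})}\cdot[\cdot,\cdot]}\right)\cap\mathrm{Diag}(\mathfrak{n})+\mathrm{Diag}(\mathfrak{n})_{>0}\right)\cap\mathfrak{t}(\mathfrak{n})_{\mathrm{tr}>0},$$ i.e. the set of all $D\in\mathfrak{t}(\mathfrak{n})$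 with $\mathrm{tr}\,D>0$ of the form $D=r\,\mathrm{m}(\lambda)+E$ with $r>0$, $\lambda\neq 0$ in the closure (in $V$) of the orbit, $\mathrm{m}(\lambda)\in\mathrm{Diag}(\mathfrak{n})$ and $E\in\mathrm{Diag}(\mathfrak{n})_{>0}$.
   Formalization: The formal theorem assumes n ≥ 4; for n = 3 the claim fails, since membership in the cone also requires 2d_1+d_2>0 (e.g. d_1=-1, d_2=3/2), and for n ≤ 2 the bracket is zero. *)

theory Defs
  imports "HOL-Analysis.Analysis"
begin

text \<open>
  The Lie algebra (in particular \<open>L\<^sub>n\<close>, with \<open>n = DIM('a)\<close>) is modelled on an arbitrary Euclidean space \<open>'a\<close> of dimension \<open>N = DIM('a)\<close>,
  whose standard orthonormal basis is the fixed basis of the Lie algebra. Throughout,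
  \<open>e :: nat \<Rightarrow> 'a\<close> is assumed to enumerate it: \<open>bij_betw e {1..DIM('a)} Basis\<close>. Hence the
  ambient inner product is the one that makes \<open>e 1, \<dots>, e N\<close> orthonormal.

  Endomorphisms and brackets are plain functions, cut out by explicit carriers. The topology of
  \<open>'a \<Rightarrow> 'a\<close> and \<open>'a \<Rightarrow> 'a \<Rightarrow> 'a\<close> is that of pointwise convergence; on the finite-dimensional
  subspaces of linear, respectively bilinear, maps it is the usual vector space topology.
\<close>

definition gl :: "('a::euclidean_space \<Rightarrow> 'a) set" where
  "gl = {A. linear A}"

definition GL :: "('a::euclidean_space \<Rightarrow> 'a) set" where
  "GL = {g \<in> gl. bij g}"

definition sym_ops :: "('a::euclidean_space \<Rightarrow> 'a) set" where
  "sym_ops = {A \<in> gl. \<forall>x y. A x \<bullet> y = x \<bullet> A y}"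

definition diag_op :: "(nat \<Rightarrow> 'a::euclidean_space) \<Rightarrow> (nat \<Rightarrow> real) \<Rightarrow> 'a \<Rightarrow> 'a" where
  "diag_op e d x = (\<Sum>i = 1..DIM('a). (d i * (x \<bullet> e i)) *\<^sub>R e i)"

definition Diag :: "(nat \<Rightarrow> 'a::euclidean_space) \<Rightarrow> ('a \<Rightarrow> 'a) set" where
  "Diag e = range (diag_op e)"

definition Diag_pos :: "(nat \<Rightarrow> 'a::euclidean_space) \<Rightarrow> ('a \<Rightarrow> 'a) set" where
  "Diag_pos e = {diag_op e d | d. \<forall>i \<in> {1..DIM('a)}. d i > 0}"

definition op_trace :: "(nat \<Rightarrow> 'a::euclidean_space) \<Rightarrow> ('a \<Rightarrow> 'a) \<Rightarrow> real" where
  "op_trace e A = (\<Sum>i = 1..DIM('a). A (e i) \<bullet> e i)"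

definition inner_gl :: "(nat \<Rightarrow> 'a::euclidean_space) \<Rightarrow> ('a \<Rightarrow> 'a) \<Rightarrow> ('a \<Rightarrow> 'a) \<Rightarrow> real" where
  "inner_gl e A B =
    (\<Sum>i = 1..DIM('a). \<Sum>j = 1..DIM('a). (A (e j) \<bullet> e i) * (B (e j) \<bullet> e i))"

definition brackets :: "('a::euclidean_space \<Rightarrow> 'a \<Rightarrow> 'a) set" where
  "brackets = {\<mu>. bilinear \<mu> \<and> (\<forall>x. \<mu> x x = 0)}"

text \<open>The coordinate of \<open>\<mu>\<close> along \<open>(e\<^sup>i \<and> e\<^sup>j) \<otimes> e\<^sub>k\<close>, for \<open>i < j\<close>, is \<open>\<mu> (e i) (e j) \<bullet> e k\<close>.\<close>

definition inner_brackets ::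
  "(nat \<Rightarrow> 'a::euclidean_space) \<Rightarrow> ('a \<Rightarrow> 'a \<Rightarrow> 'a) \<Rightarrow> ('a \<Rightarrow> 'a \<Rightarrow> 'a) \<Rightarrow> real" where
  "inner_brackets e \<mu> \<nu> =
    (\<Sum>j = 1..DIM('a). \<Sum>i = 1..<j. \<Sum>k = 1..DIM('a).
      (\<mu> (e i) (e j) \<bullet> e k) * (\<nu> (e i) (e j) \<bullet> e k))"

definition GL_act :: "('a \<Rightarrow> 'a) \<Rightarrow> ('a \<Rightarrow> 'a \<Rightarrow> 'a) \<Rightarrow> 'a::euclidean_space \<Rightarrow> 'a \<Rightarrow> 'a" where
  "GL_act g \<mu> = (\<lambda>x y. g (\<mu> (inv g x) (inv g y)))"

definition gl_act :: "('a \<Rightarrow> 'a) \<Rightarrow> ('a \<Rightarrow> 'a \<Rightarrow> 'a) \<Rightarrow> 'a::euclidean_space \<Rightarrow> 'a \<Rightarrow> 'a" where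
  "gl_act E \<mu> = (\<lambda>x y. E (\<mu> x y) - \<mu> (E x) y - \<mu> x (E y))"

text \<open>Only meaningful for nonzero \<open>\<mu> \<in> brackets\<close>, where the defining property has exactly one
  solution.\<close>

definition moment_map ::
  "(nat \<Rightarrow> 'a::euclidean_space) \<Rightarrow> ('a \<Rightarrow> 'a \<Rightarrow> 'a) \<Rightarrow> 'a \<Rightarrow> 'a" where
  "moment_map e \<mu> =
    (THE M. M \<in> sym_ops \<and>
      (\<forall>E \<in> sym_ops. inner_gl e M E
        = 1 / inner_brackets e \<mu> \<mu> * inner_brackets e (gl_act E \<mu>) \<mu>))"

definition centralizer_GL :: "('a::euclidean_space \<Rightarrow> 'a) set \<Rightarrow> ('a \<Rightarrow> 'a) set" where
  "centralizer_GL T = {g \<in> GL. \<forall>D \<in> T. g \<circ> D = D \<circ> g}"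

definition torus_group :: "('a::euclidean_space \<Rightarrow> 'a) set \<Rightarrow> ('a \<Rightarrow> 'a) set" where
  "torus_group T = connected_component_set (centralizer_GL T) id"

definition orbit_closure ::
  "('a \<Rightarrow> 'a \<Rightarrow> 'a) \<Rightarrow> ('a \<Rightarrow> 'a) set \<Rightarrow> ('a::euclidean_space \<Rightarrow> 'a \<Rightarrow> 'a) set" where
  "orbit_closure \<mu> T = closure ((\<lambda>g. GL_act g \<mu>) ` torus_group T) \<inter> brackets"

definition cone_C ::
  "(nat \<Rightarrow> 'a::euclidean_space) \<Rightarrow> ('a \<Rightarrow> 'a \<Rightarrow> 'a) \<Rightarrow> ('a \<Rightarrow> 'a) set \<Rightarrow> ('a \<Rightarrow> 'a) set" where
  "cone_C e \<mu> T =
    {D \<in> T. op_trace e D > 0 \<and>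
      (\<exists>r > 0. \<exists>\<nu> \<in> orbit_closure \<mu> T. \<exists>E \<in> Diag_pos e.
        \<nu> \<noteq> (\<lambda>x y. 0) \<and> moment_map e \<nu> \<in> Diag e \<and>
        D = (\<lambda>x. r *\<^sub>R moment_map e \<nu> x + E x))}"

definition L_bracket :: "(nat \<Rightarrow> 'a::euclidean_space) \<Rightarrow> 'a \<Rightarrow> 'a \<Rightarrow> 'a" where
  "L_bracket e x y =
    (\<Sum>i = 2..<DIM('a). ((x \<bullet> e 1) * (y \<bullet> e i) - (x \<bullet> e i) * (y \<bullet> e 1)) *\<^sub>R e (Suc i))"

definition L_diag :: "(nat \<Rightarrow> 'a::euclidean_space) \<Rightarrow> real \<Rightarrow> real \<Rightarrow> 'a \<Rightarrow> 'a" where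
  "L_diag e d1 d2 = diag_op e (\<lambda>i. if i = 1 then d1 else (real i - 2) * d1 + d2)"

definition L_torus :: "(nat \<Rightarrow> 'a::euclidean_space) \<Rightarrow> ('a \<Rightarrow> 'a) set" where
  "L_torus e = {L_diag e d1 d2 | d1 d2. True}"

definition L_cone :: "(nat \<Rightarrow> 'a::euclidean_space) \<Rightarrow> ('a \<Rightarrow> 'a) set" where
  "L_cone e = cone_C e (L_bracket e) (L_torus e)"

lemma enum_inner:
  fixes e :: "nat \<Rightarrow> 'a::euclidean_space"
  assumes "bij_betw e {1..DIM('a)} Basis" "i \<in> {1..DIM('a)}" "j \<in> {1..DIM('a)}"
  shows "e i \<bullet> e j = (if i = j then 1 else 0)"
proof -
  have "e i \<in> Basis" "e j \<in> Basis"
    using bij_betwE[OF assms(1)] assms(2,3) by blast+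
  moreover have "e i = e j \<longleftrightarrow> i = j"
    using inj_on_eq_iff[OF bij_betw_imp_inj_on[OF assms(1)] assms(2,3)] .
  ultimately show ?thesis
    by (simp add: inner_Basis)
qed

lemma L_bracket_in_brackets: "L_bracket e \<in> brackets"
proof -
  have "linear (L_bracket e x)" for x
    unfolding L_bracket_def
    by (intro linear_compose_sum ballI linearI) (simp_all add: inner_simps algebra_simps)
  moreover have "linear (\<lambda>x. L_bracket e x y)" for y
    unfolding L_bracket_def
    by (intro linear_compose_sum ballI linearI) (simp_all add: inner_simps algebra_simps)
  moreover have "L_bracket e x x = 0" for x
    by (simp add: L_bracket_def mult.commute)
  ultimately show ?thesis
    by (simp add: brackets_def bilinear_def)
qed

lemma L_bracket_basis:
  fixes e :: "nat \<Rightarrow> 'a::euclidean_space"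
  assumes e: "bij_betw e {1..DIM('a)} Basis" and ij: "1 \<le> i" "i < j" "j \<le> DIM('a)"
  shows "L_bracket e (e i) (e j) = (if i = 1 \<and> j < DIM('a) then e (Suc j) else 0)"
proof -
  have "L_bracket e (e i) (e j)
      = (\<Sum>k = 2..<DIM('a). if k = j then (if i = 1 then e (Suc k) else 0) else 0)"
    unfolding L_bracket_def using ij by (intro sum.cong) (auto simp: enum_inner[OF e])
  also have "\<dots> = (if i = 1 \<and> j < DIM('a) then e (Suc j) else 0)"
    using ij by (auto)
  finally show ?thesis .
qed

lemma diag_op_basis:
  fixes e :: "nat \<Rightarrow> 'a::euclidean_space"
  assumes e: "bij_betw e {1..DIM('a)} Basis" and i: "i \<in> {1..DIM('a)}"
  shows "diag_op e d (e i) = d i *\<^sub>R e i"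
proof -
  have "diag_op e d (e i) = (\<Sum>k = 1..DIM('a). if k = i then d k *\<^sub>R e k else 0)"
    unfolding diag_op_def using i by (intro sum.cong) (auto simp: enum_inner[OF e])
  also have "\<dots> = d i *\<^sub>R e i"
    using i by simp
  finally show ?thesis .
qed

end

theory Submission
  imports Defs
begin

text \<open>
  The torus contains \<open>Diag(1,\<dots>,n)\<close>, so its centralizer consists of diagonal operators and every
  \<open>\<nu>\<close> in the orbit closure satisfies \<open>\<nu>(e\<^sub>1,e\<^sub>j) = a\<^sub>j e\<^sub>j\<^sub>+\<^sub>1\<close> with all other brackets zero. The moment
  map of such a \<open>\<nu>\<close> is diagonal: it is the average of the roots \<open>E\<^sub>j\<^sub>+\<^sub>1 - E\<^sub>1 - E\<^sub>j\<close> with weights \<open>a\<^sub>j\<^sup>2\<close>.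
  Hence \<open>D\<close> lies in the cone iff its trace is positive and \<open>D - \<Sum>\<^sub>j b\<^sub>j (E\<^sub>j\<^sub>+\<^sub>1 - E\<^sub>1 - E\<^sub>j)\<close> has positive
  entries for some nonzero \<open>b \<ge> 0\<close>. The last entry, and the sum of all entries but the first, give
  the two inequalities. Conversely, they make all tail sums of \<open>d\<^sub>2, d\<^sub>1 + d\<^sub>2, \<dots>, (n-2) d\<^sub>1 + d\<^sub>2\<close>
  positive, and these tail sums, slightly decreased, can serve as \<open>b\<close>.
\<close>

section \<open>Combinations of the roots\<close>

text \<open>The \<open>i\<close>-th diagonal entry of the sum of b_j (E_{j+1} - E_1 - E_j). The
  \<open>j\<close>-th root is the weight with which diagonal operators act on the structure constant
  of [e_1, e_j] = e_{j+1}.\<close>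

definition root_comb :: "nat \<Rightarrow> (nat \<Rightarrow> real) \<Rightarrow> nat \<Rightarrow> real" where
  "root_comb n b i =
    (\<Sum>j = 2..<n. b j * (of_bool (i = Suc j) - of_bool (i = 1) - of_bool (i = j)))"

text \<open>Exchanging the sums pairs each root with \<open>x\<close> separately. Taking the
  diagonal of an operator as \<open>x\<close> yields the moment map; taking the indicator of the
  indices other than 1 makes every root vanish.\<close>

lemma sum_root_comb:
  "(\<Sum>i = 1..n. root_comb n b i * x i) = (\<Sum>j = 2..<n. b j * (x (Suc j) - x 1 - x j))"
proof -
  have "(\<Sum>i = 1..n. root_comb n b i * x i) =
    (\<Sum>j = 2..<n. b j * (\<Sum>i = 1..n. (of_bool (i = Suc j) - of_bool (i = 1) - of_bool (i = j)) * x i))"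
    unfolding root_comb_def sum_distrib_right
    by (subst sum.swap) (simp add: sum_distrib_left mult.assoc)
  also have "\<dots> = (\<Sum>j = 2..<n. b j * (x (Suc j) - x 1 - x j))"
  proof (rule sum.cong)
    fix j assume "j \<in> {2..<n}"
    then have "(\<Sum>i = 1..n. (of_bool (i = Suc j) - of_bool (i = 1) - of_bool (i = j)) * x i) =
      x (Suc j) - x 1 - x j"
      by (simp add: left_diff_distrib sum_subtractf of_bool_def if_distrib [of "\<lambda>c. c * _"]
          cong: if_cong)
    then show "b j * (\<Sum>i = 1..n. (of_bool (i = Suc j) - of_bool (i = 1) - of_bool (i = j)) * x i) =
      b j * (x (Suc j) - x 1 - x j)" by simp
  qed simp
  finally show ?thesis .
qed

lemma root_comb_cmult: "root_comb n (\<lambda>j. c * b j) i = c * root_comb n b i"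
  by (simp add: root_comb_def sum_distrib_left mult.assoc)

lemma root_comb_1: "root_comb n b 1 = - (\<Sum>j = 2..<n. b j)"
  unfolding root_comb_def sum_negf [symmetric] by (rule sum.cong) auto

text \<open>Away from entry 1, only two roots can meet entry \<open>i\<close>: the one ending in
  e_i, with index \<open>i - 1\<close>, and the one starting from e_i, with index \<open>i\<close>.
  The conditions say when these indices lie in \<open>{2..<n}\<close>.\<close>

lemma root_comb_ge_2:
  assumes "2 \<le> i"
  shows "root_comb n b i =
    (if 3 \<le> i \<and> i \<le> n then b (i - 1) else 0) - (if i < n then b i else 0)"
proof -
  have "root_comb n b i = (\<Sum>j = 2..<n. (if j = i - 1 then b j else 0) - (if j = i then b j else 0))"
    unfolding root_comb_def using assms by (intro sum.cong) auto
  then show ?thesis using assms by (auto simp: sum_subtractf)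
qed

section \<open>Coordinates and diagonal operators\<close>

context
  fixes e :: "nat \<Rightarrow> 'a::euclidean_space"
  assumes e: "bij_betw e {1..DIM('a)} Basis"
begin

lemma enum_expansion: "(\<Sum>i = 1..DIM('a). (x \<bullet> e i) *\<^sub>R e i) = x"
  using sum.reindex_bij_betw[OF e, of "\<lambda>b. (x \<bullet> b) *\<^sub>R b"] by (simp add: euclidean_representation)

lemma enum_eqI:
  assumes "\<And>i. i \<in> {1..DIM('a)} \<Longrightarrow> x \<bullet> e i = y \<bullet> e i"
  shows "x = y"
proof -
  have "(\<Sum>i = 1..DIM('a). (x \<bullet> e i) *\<^sub>R e i) = (\<Sum>i = 1..DIM('a). (y \<bullet> e i) *\<^sub>R e i)"
    using assms by simp
  then show ?thesis by (simp only: enum_expansion)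
qed

lemma Basis_enumE:
  assumes "b \<in> Basis"
  obtains i where "i \<in> {1..DIM('a)}" "b = e i"
  using assms bij_betw_imp_surj_on[OF e] by blast

lemma linear_enum_eqI:
  assumes "linear f" "linear g" "\<And>i. i \<in> {1..DIM('a)} \<Longrightarrow> f (e i) = g (e i)"
  shows "f = g"
  using assms by (metis linear_eq_stdbasis Basis_enumE)

lemma bracket_swap:
  assumes "\<nu> \<in> brackets"
  shows "\<nu> x y = - \<nu> y x"
proof -
  have b: "bilinear \<nu>" and z: "\<And>x. \<nu> x x = 0" using assms by (auto simp: brackets_def)
  have "\<nu> (x + y) (x + y) = \<nu> x x + \<nu> x y + (\<nu> y x + \<nu> y y)"
    by (simp only: bilinear_ladd[OF b] bilinear_radd[OF b] add_ac)
  then have "\<nu> x y + \<nu> y x = 0" using z by simp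
  then show ?thesis by (simp add: eq_neg_iff_add_eq_0)
qed

lemma diag_op_inner:
  assumes "i \<in> {1..DIM('a)}"
  shows "diag_op e d x \<bullet> e i = d i * (x \<bullet> e i)"
proof -
  have "diag_op e d x \<bullet> e i = (\<Sum>k = 1..DIM('a). if k = i then d k * (x \<bullet> e k) else 0)"
    unfolding diag_op_def inner_sum_left using assms
    by (intro sum.cong) (auto simp: enum_inner[OF e])
  then show ?thesis using assms by simp
qed

lemma linear_diag_op: "linear (diag_op e d)"
  by (intro linearI enum_eqI) (simp_all add: diag_op_inner inner_simps algebra_simps)

lemma diag_op_cong: "(\<And>i. i \<in> {1..DIM('a)} \<Longrightarrow> c i = d i) \<Longrightarrow> diag_op e c = diag_op e d"
  by (rule ext, rule enum_eqI) (simp add: diag_op_inner)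

lemma diag_op_comp: "diag_op e c (diag_op e d x) = diag_op e (\<lambda>i. c i * d i) x"
  by (rule enum_eqI) (simp add: diag_op_inner)

lemma diag_op_one: "diag_op e (\<lambda>i. 1) = id"
  by (rule ext, rule enum_eqI) (simp add: diag_op_inner)

lemma diag_op_sym: "diag_op e d \<in> sym_ops"
proof -
  have "diag_op e d x \<bullet> y = x \<bullet> diag_op e d y" for x y
    unfolding diag_op_def inner_sum_left inner_sum_right
    by (rule sum.cong) (simp_all add: inner_commute)
  then show ?thesis by (simp add: sym_ops_def gl_def linear_diag_op)
qed

lemma inner_gl_diag_op:
  "inner_gl e (diag_op e d) E = (\<Sum>i = 1..DIM('a). d i * (E (e i) \<bullet> e i))"
  unfolding inner_gl_def
proof (rule sum.cong)
  fix i assume i: "i \<in> {1..DIM('a)}"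
  have "(\<Sum>j = 1..DIM('a). (diag_op e d (e j) \<bullet> e i) * (E (e j) \<bullet> e i)) =
    (\<Sum>j = 1..DIM('a). if j = i then d i * (E (e i) \<bullet> e i) else 0)"
    using i by (intro sum.cong) (auto simp: diag_op_inner enum_inner[OF e])
  then show "(\<Sum>j = 1..DIM('a). (diag_op e d (e j) \<bullet> e i) * (E (e j) \<bullet> e i)) = d i * (E (e i) \<bullet> e i)"
    using i by simp
qed simp

text \<open>Testing against the difference \<open>M - M'\<close>, itself symmetric, produces the sum
  of its squared matrix entries. This provides the uniqueness behind the definite description in
  \<open>moment_map\<close>.\<close>

lemma sym_ops_eqI:
  assumes "M \<in> sym_ops" "M' \<in> sym_ops" "\<And>E. E \<in> sym_ops \<Longrightarrow> inner_gl e M E = inner_gl e M' E"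
  shows "M = M'"
proof -
  let ?E = "\<lambda>x. M x - M' x"
  have E: "?E \<in> sym_ops"
    using assms(1,2) by (auto simp: sym_ops_def gl_def linear_compose_sub inner_diff_left inner_diff_right)
  have "(\<Sum>i = 1..DIM('a). \<Sum>j = 1..DIM('a). (?E (e j) \<bullet> e i)\<^sup>2) = inner_gl e M ?E - inner_gl e M' ?E"
    unfolding inner_gl_def sum_subtractf [symmetric]
    by (intro sum.cong) (simp_all add: inner_diff_left power2_eq_square algebra_simps)
  also have "\<dots> = 0" using assms(3)[OF E] by simp
  finally have *: "(\<Sum>i = 1..DIM('a). \<Sum>j = 1..DIM('a). (?E (e j) \<bullet> e i)\<^sup>2) = 0" .
  have "?E (e j) \<bullet> e i = 0" if "i \<in> {1..DIM('a)}" "j \<in> {1..DIM('a)}" for i j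
  proof -
    have "(\<Sum>j = 1..DIM('a). (?E (e j) \<bullet> e i)\<^sup>2) = 0"
      using * that(1) by (subst (asm) sum_nonneg_eq_0_iff) (auto intro: sum_nonneg)
    then show ?thesis using that(2) by (subst (asm) sum_nonneg_eq_0_iff) auto
  qed
  then have "\<And>j. j \<in> {1..DIM('a)} \<Longrightarrow> M (e j) = M' (e j)"
    by (intro enum_eqI) (simp add: inner_diff_left)
  then show ?thesis
    using assms(1,2) by (intro linear_enum_eqI) (auto simp: sym_ops_def gl_def)
qed

section \<open>Brackets of filiform shape and their moment map\<close>

text \<open>Pairs with \<open>i < j\<close> suffice, since membership in \<open>brackets\<close>
  gives skew-symmetry. Only the values of \<open>a\<close> on \<open>{2..<DIM('a)}\<close>
  matter.\<close>

definition filiform_bracket :: "(nat \<Rightarrow> real) \<Rightarrow> ('a \<Rightarrow> 'a \<Rightarrow> 'a) \<Rightarrow> bool" where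
  "filiform_bracket a \<nu> \<longleftrightarrow> \<nu> \<in> brackets \<and> (\<forall>i j. 1 \<le> i \<and> i < j \<and> j \<le> DIM('a) \<longrightarrow>
    \<nu> (e i) (e j) = (if i = 1 \<and> j < DIM('a) then a j *\<^sub>R e (Suc j) else 0))"

lemma filiform_bracket_basis:
  assumes "filiform_bracket a \<nu>" "1 \<le> i" "i < j" "j \<le> DIM('a)"
  shows "\<nu> (e i) (e j) = (if i = 1 \<and> j < DIM('a) then a j *\<^sub>R e (Suc j) else 0)"
  using assms by (auto simp: filiform_bracket_def)

lemma filiform_bracket_nonzero:
  assumes "filiform_bracket a \<nu>" "j \<in> {2..<DIM('a)}" "a j \<noteq> 0"
  shows "\<nu> \<noteq> (\<lambda>x y. 0)"
proof -
  have "\<nu> (e 1) (e j) \<bullet> e (Suc j) = a j"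
    using assms(2) by (simp add: filiform_bracket_basis[OF assms(1)] enum_inner[OF e] del: One_nat_def)
  then have "\<nu> (e 1) (e j) \<noteq> 0" using assms(3) by force
  then show ?thesis by blast
qed

text \<open>Every other coordinate of \<open>\<nu>\<close> is zero. The first argument stays
  arbitrary because \<open>gl_act E \<nu>\<close> need not have filiform shape.\<close>

lemma inner_brackets_filiform:
  assumes "filiform_bracket a \<nu>"
  shows "inner_brackets e \<mu> \<nu> = (\<Sum>j = 2..<DIM('a). (\<mu> (e 1) (e j) \<bullet> e (Suc j)) * a j)"
proof -
  have *: "(\<Sum>i = 1..<j. \<Sum>k = 1..DIM('a). (\<mu> (e i) (e j) \<bullet> e k) * (\<nu> (e i) (e j) \<bullet> e k)) =
    (if j \<in> {2..<DIM('a)} then (\<mu> (e 1) (e j) \<bullet> e (Suc j)) * a j else 0)"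
    if j: "j \<in> {1..DIM('a)}" for j
  proof -
    have "(\<Sum>k = 1..DIM('a). (\<mu> (e i) (e j) \<bullet> e k) * (\<nu> (e i) (e j) \<bullet> e k)) =
      (if i = 1 then if j < DIM('a) then (\<mu> (e 1) (e j) \<bullet> e (Suc j)) * a j else 0 else 0)"
      if i: "i \<in> {1..<j}" for i
    proof (cases "i = 1 \<and> j < DIM('a)")
      case True
      have "(\<Sum>k = 1..DIM('a). (\<mu> (e i) (e j) \<bullet> e k) * (\<nu> (e i) (e j) \<bullet> e k)) =
        (\<Sum>k = 1..DIM('a). if k = Suc j then (\<mu> (e 1) (e j) \<bullet> e (Suc j)) * a j else 0)"
        using True i j by (intro sum.cong)
          (auto simp: filiform_bracket_basis[OF assms] enum_inner[OF e])
      then show ?thesis using True by simp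
    next
      case False
      then show ?thesis using i j by (auto simp: filiform_bracket_basis[OF assms])
    qed
    then have "(\<Sum>i = 1..<j. \<Sum>k = 1..DIM('a). (\<mu> (e i) (e j) \<bullet> e k) * (\<nu> (e i) (e j) \<bullet> e k)) =
      (\<Sum>i = 1..<j. if i = 1 then if j < DIM('a) then (\<mu> (e 1) (e j) \<bullet> e (Suc j)) * a j else 0 else 0)"
      by (intro sum.cong) auto
    then show ?thesis by auto
  qed
  have "inner_brackets e \<mu> \<nu> =
    (\<Sum>j = 1..DIM('a). if j \<in> {2..<DIM('a)} then (\<mu> (e 1) (e j) \<bullet> e (Suc j)) * a j else 0)"
    unfolding inner_brackets_def using * by (rule sum.cong[OF refl])
  also have "\<dots> = (\<Sum>j = 2..<DIM('a). (\<mu> (e 1) (e j) \<bullet> e (Suc j)) * a j)"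
    by (rule sum.mono_neutral_cong_right) auto
  finally show ?thesis .
qed

text \<open>In this coordinate, \<open>left\<close> and \<open>right\<close> show that perturbing
  either argument of \<open>\<nu>\<close> is felt only through its e_1 or e_j component. Hence only
  diagonal entries of \<open>E\<close> survive, which is why the moment map is diagonal.\<close>

lemma gl_act_filiform:
  assumes "filiform_bracket a \<nu>" "linear E" and j: "j \<in> {2..<DIM('a)}"
  shows "gl_act E \<nu> (e 1) (e j) \<bullet> e (Suc j) =
    a j * (E (e (Suc j)) \<bullet> e (Suc j) - E (e 1) \<bullet> e 1 - E (e j) \<bullet> e j)"
proof -
  have \<nu>: "\<nu> \<in> brackets" using assms(1) by (simp add: filiform_bracket_def)
  then have b: "bilinear \<nu>" and z: "\<And>x. \<nu> x x = 0" by (auto simp: brackets_def)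
  have left: "\<nu> x (e j) \<bullet> e (Suc j) = (x \<bullet> e 1) * a j" for x
  proof -
    have lin: "linear (\<lambda>x. \<nu> x (e j))" using b by (simp add: bilinear_def)
    have c: "\<nu> (e i) (e j) \<bullet> e (Suc j) = (if i = 1 then a j else 0)" if i: "i \<in> {1..DIM('a)}" for i
    proof (cases i j rule: linorder_cases)
      case less
      then show ?thesis using i j by (auto simp: filiform_bracket_basis[OF assms(1)] enum_inner[OF e])
    next
      case equal
      then show ?thesis using j z by simp
    next
      case greater
      then have "\<nu> (e j) (e i) = 0" using i j by (auto simp: filiform_bracket_basis[OF assms(1)])
      then show ?thesis using greater j bracket_swap[OF \<nu>, of "e i" "e j"] by simp
    qed
    have "\<nu> x (e j) \<bullet> e (Suc j) = (\<Sum>i = 1..DIM('a). (x \<bullet> e i) * (\<nu> (e i) (e j) \<bullet> e (Suc j)))"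
      by (subst enum_expansion[of x, symmetric])
        (simp add: linear_sum[OF lin] linear_cmul[OF lin] inner_sum_left del: One_nat_def)
    also have "\<dots> = (\<Sum>i = 1..DIM('a). if i = 1 then (x \<bullet> e 1) * a j else 0)"
      using c by (intro sum.cong) auto
    finally show ?thesis by simp
  qed
  have right: "\<nu> (e 1) x \<bullet> e (Suc j) = (x \<bullet> e j) * a j" for x
  proof -
    have lin: "linear (\<nu> (e 1))" using b by (simp add: bilinear_def)
    have c: "\<nu> (e 1) (e i) \<bullet> e (Suc j) = (if i = j then a j else 0)" if i: "i \<in> {1..DIM('a)}" for i
    proof (cases "i = 1")
      case True
      then show ?thesis using j z by simp
    next
      case False
      then show ?thesis using i j by (auto simp: filiform_bracket_basis[OF assms(1)] enum_inner[OF e])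
    qed
    have "\<nu> (e 1) x \<bullet> e (Suc j) = (\<Sum>i = 1..DIM('a). (x \<bullet> e i) * (\<nu> (e 1) (e i) \<bullet> e (Suc j)))"
      by (subst enum_expansion[of x, symmetric])
        (simp add: linear_sum[OF lin] linear_cmul[OF lin] inner_sum_left del: One_nat_def)
    also have "\<dots> = (\<Sum>i = 1..DIM('a). if i = j then (x \<bullet> e j) * a j else 0)"
      using c by (intro sum.cong) auto
    finally show ?thesis using j by simp
  qed
  have "\<nu> (e 1) (e j) = a j *\<^sub>R e (Suc j)"
    using j by (simp add: filiform_bracket_basis[OF assms(1)])
  then show ?thesis
    by (simp add: gl_act_def inner_diff_left left right linear_cmul[OF assms(2)] algebra_simps
        del: One_nat_def)
qed

text \<open>This covers \<open>\<nu> = 0\<close>, where division by \<open>0\<close> makes both sides zero.\<close>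

lemma moment_map_filiform:
  assumes \<nu>: "filiform_bracket a \<nu>"
  shows "moment_map e \<nu> = diag_op e
    (root_comb DIM('a) (\<lambda>j. 1 / (\<Sum>k = 2..<DIM('a). (a k)\<^sup>2) * (a j)\<^sup>2))"
proof -
  let ?S = "\<Sum>k = 2..<DIM('a). (a k)\<^sup>2"
  let ?M = "diag_op e (root_comb DIM('a) (\<lambda>j. 1 / ?S * (a j)\<^sup>2))"
  have S: "inner_brackets e \<nu> \<nu> = ?S"
    unfolding inner_brackets_filiform[OF \<nu>]
    by (intro sum.cong)
      (auto simp: filiform_bracket_basis[OF \<nu>] enum_inner[OF e] power2_eq_square)
  have M: "inner_gl e ?M E = 1 / inner_brackets e \<nu> \<nu> * inner_brackets e (gl_act E \<nu>) \<nu>"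
    if "E \<in> sym_ops" for E
  proof -
    have "linear E" using that by (simp add: sym_ops_def gl_def)
    then show ?thesis
      unfolding S
      \<comment> \<open>Both sides become sums over the roots, each root being evaluated on the
        diagonal of \<open>E\<close>.\<close>
      unfolding inner_gl_diag_op sum_root_comb inner_brackets_filiform[OF \<nu>] sum_distrib_left
      by (intro sum.cong)
        (simp_all add: gl_act_filiform[OF \<nu>] power2_eq_square del: One_nat_def)
  qed
  show ?thesis
    unfolding moment_map_def
  proof (rule the_equality)
    show "?M \<in> sym_ops \<and> (\<forall>E\<in>sym_ops. inner_gl e ?M E =
        1 / inner_brackets e \<nu> \<nu> * inner_brackets e (gl_act E \<nu>) \<nu>)"
      using M diag_op_sym by blast
  next
    fix N
    assume "N \<in> sym_ops \<and> (\<forall>E\<in>sym_ops. inner_gl e N E =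
        1 / inner_brackets e \<nu> \<nu> * inner_brackets e (gl_act E \<nu>) \<nu>)"
    then show "N = ?M" using M diag_op_sym by (intro sym_ops_eqI) auto
  qed
qed

section \<open>Centralizer of the torus and orbit closure\<close>

lemma centralizer_L_torus_diag:
  assumes "g \<in> centralizer_GL (L_torus e)"
  obtains d where "g = diag_op e d" "\<forall>i \<in> {1..DIM('a)}. d i \<noteq> 0"
proof -
  \<comment> \<open>These parameters give the entries 1, 2, ..., N. They are pairwise distinct, so
    an operator commuting with \<open>?D\<close> preserves each line spanned by a basis
    vector.\<close>
  let ?D = "L_diag e 1 2"
  have D: "?D = diag_op e real"
    unfolding L_diag_def by (rule diag_op_cong) auto
  have g: "linear g" "inj g" "g \<circ> ?D = ?D \<circ> g"
    using assms by (auto simp: centralizer_GL_def GL_def gl_def L_torus_def bij_def)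
  have off: "g (e i) \<bullet> e k = 0" if "i \<in> {1..DIM('a)}" "k \<in> {1..DIM('a)}" "i \<noteq> k" for i k
  proof -
    have "g (?D (e i)) = ?D (g (e i))" using fun_cong[OF g(3)] by simp
    then have "real i *\<^sub>R g (e i) = diag_op e real (g (e i))"
      using that by (simp add: D diag_op_basis[OF e] linear_cmul[OF g(1)])
    then have "(real i *\<^sub>R g (e i)) \<bullet> e k = real k * (g (e i) \<bullet> e k)"
      using that by (simp add: diag_op_inner)
    then show ?thesis using that by simp
  qed
  define d where "d i = g (e i) \<bullet> e i" for i
  have gd: "g = diag_op e d"
  proof (rule linear_enum_eqI[OF g(1) linear_diag_op], rule enum_eqI)
    fix i k assume "i \<in> {1..DIM('a)}" "k \<in> {1..DIM('a)}"
    then show "g (e i) \<bullet> e k = diag_op e d (e i) \<bullet> e k"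
      using off[of i k] by (auto simp: diag_op_inner enum_inner[OF e] d_def)
  qed
  moreover have "d i \<noteq> 0" if i: "i \<in> {1..DIM('a)}" for i
  proof
    assume "d i = 0"
    then have "g (e i) = g 0" using gd i by (simp add: diag_op_basis[OF e] linear_0[OF linear_diag_op])
    then have "e i = 0" using g(2) by (simp add: inj_eq)
    then show False using enum_inner[OF e i i] by simp
  qed
  ultimately show ?thesis using that by blast
qed

lemma inv_diag_op:
  assumes "\<And>i. i \<in> {1..DIM('a)} \<Longrightarrow> d i \<noteq> 0"
  shows "bij (diag_op e d)" "inv (diag_op e d) = diag_op e (\<lambda>i. 1 / d i)"
proof -
  have l: "diag_op e (\<lambda>i. 1 / d i) (diag_op e d x) = x"
   and r: "diag_op e d (diag_op e (\<lambda>i. 1 / d i) x) = x" for x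
    using assms by (rule_tac [!] enum_eqI) (simp_all add: diag_op_inner)
  show "bij (diag_op e d)" by (rule bij_betw_byWitness[of _ "diag_op e (\<lambda>i. 1 / d i)"]) (simp_all add: l r)
  show "inv (diag_op e d) = diag_op e (\<lambda>i. 1 / d i)"
    by (rule inv_equality) (simp_all add: l r)
qed

text \<open>The inverse contributes \<open>1 / d 1\<close> and \<open>1 / d j\<close> through the
  two arguments, and the outer operator scales e_{j+1} by \<open>d (Suc j)\<close>.\<close>

lemma GL_act_L_bracket_filiform:
  assumes d: "\<And>i. i \<in> {1..DIM('a)} \<Longrightarrow> d i \<noteq> 0"
  shows "filiform_bracket (\<lambda>j. d (Suc j) / (d 1 * d j)) (GL_act (diag_op e d) (L_bracket e))"
proof -
  let ?g' = "diag_op e (\<lambda>i. 1 / d i)"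
  have L: "bilinear (L_bracket e)" "\<And>x. L_bracket e x x = 0"
    using L_bracket_in_brackets[of e] by (auto simp: brackets_def)
  have act: "GL_act (diag_op e d) (L_bracket e) = (\<lambda>x y. diag_op e d (L_bracket e (?g' x) (?g' y)))"
    using inv_diag_op(2)[of d] d by (simp add: GL_act_def)
  have 1: "linear (\<lambda>y. diag_op e d (L_bracket e (?g' x) (?g' y)))" for x
    using linear_compose[OF linear_compose[OF linear_diag_op] linear_diag_op, of "L_bracket e (?g' x)"]
      L(1) by (simp add: bilinear_def o_def)
  have 2: "linear (\<lambda>x. diag_op e d (L_bracket e (?g' x) (?g' y)))" for y
    using linear_compose[OF linear_compose[OF linear_diag_op] linear_diag_op, of "\<lambda>x. L_bracket e x (?g' y)"]
      L(1) by (simp add: bilinear_def o_def)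
  have "GL_act (diag_op e d) (L_bracket e) \<in> brackets"
    unfolding act brackets_def using 1 2 L(2) by (auto simp: bilinear_def linear_0[OF linear_diag_op])
  moreover have "GL_act (diag_op e d) (L_bracket e) (e i) (e j) =
      (if i = 1 \<and> j < DIM('a) then (d (Suc j) / (d 1 * d j)) *\<^sub>R e (Suc j) else 0)"
    if "1 \<le> i" "i < j" "j \<le> DIM('a)" for i j
    using that
    by (simp add: act diag_op_basis[OF e] bilinear_lmul[OF L(1)] bilinear_rmul[OF L(1)]
        L_bracket_basis[OF e] linear_cmul[OF linear_diag_op] linear_0[OF linear_diag_op])
  ultimately show ?thesis by (simp add: filiform_bracket_def)
qed

text \<open>The vanishing of a coordinate is a closed condition for pointwise convergence. It holds
  on the orbit and hence on its closure.\<close>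

lemma orbit_closure_filiform:
  assumes "\<nu> \<in> orbit_closure (L_bracket e) (L_torus e)"
  obtains a where "filiform_bracket a \<nu>"
proof -
  let ?O = "(\<lambda>g. GL_act g (L_bracket e)) ` torus_group (L_torus e)"
  \<comment> \<open>The triples whose coordinate must vanish. For \<open>j = DIM('a)\<close> every
    \<open>k\<close> occurs, as \<open>Suc j\<close> is out of range.\<close>
  let ?I = "{(i, j, k). 1 \<le> i \<and> i < j \<and> j \<le> DIM('a) \<and> 1 \<le> k \<and> k \<le> DIM('a) \<and> \<not> (i = 1 \<and> k = Suc j)}"
  let ?C = "\<Inter>(i, j, k)\<in>?I. {\<nu>. \<nu> (e i) (e j) \<bullet> e k = 0}"
  have "closed {\<nu> :: 'a \<Rightarrow> 'a \<Rightarrow> 'a. \<nu> x y \<bullet> z = 0}" for x y z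
  proof -
    have "continuous_on UNIV (\<lambda>\<nu> :: 'a \<Rightarrow> 'a \<Rightarrow> 'a. \<nu> x y)"
      by (rule continuous_on_product_then_coordinatewise[OF continuous_on_product_coordinates])
    then have "continuous_on UNIV (\<lambda>\<nu> :: 'a \<Rightarrow> 'a \<Rightarrow> 'a. \<nu> x y \<bullet> z)"
      by (rule continuous_on_inner[OF _ continuous_on_const])
    then show ?thesis
      by (rule closed_Collect_eq[OF _ continuous_on_const])
  qed
  then have "closed ?C" by (intro closed_INT) auto
  moreover have "?O \<subseteq> ?C"
  proof
    fix \<nu> assume "\<nu> \<in> ?O"
    then obtain g where g: "g \<in> torus_group (L_torus e)" "\<nu> = GL_act g (L_bracket e)" by blast
    then have "g \<in> centralizer_GL (L_torus e)"
      using connected_component_subset by (auto simp: torus_group_def)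
    then obtain d where d: "g = diag_op e d" "\<forall>i \<in> {1..DIM('a)}. d i \<noteq> 0"
      by (rule centralizer_L_torus_diag)
    then have "filiform_bracket (\<lambda>j. d (Suc j) / (d 1 * d j)) \<nu>"
      using GL_act_L_bracket_filiform g(2) by blast
    then show "\<nu> \<in> ?C"
      by (auto simp: filiform_bracket_basis enum_inner[OF e])
  qed
  ultimately have C: "\<nu> \<in> ?C" and \<nu>: "\<nu> \<in> brackets"
    using assms closure_minimal[of ?O ?C] by (auto simp: orbit_closure_def)
  have "filiform_bracket (\<lambda>j. \<nu> (e 1) (e j) \<bullet> e (Suc j)) \<nu>"
    unfolding filiform_bracket_def
  proof (intro conjI allI impI \<nu> enum_eqI)
    fix i j k assume *: "1 \<le> i \<and> i < j \<and> j \<le> DIM('a)" "k \<in> {1..DIM('a)}"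
    have 0: "\<nu> (e i) (e j) \<bullet> e k = 0" if "\<not> (i = 1 \<and> k = Suc j)"
      using C * that by auto
    show "\<nu> (e i) (e j) \<bullet> e k =
      (if i = 1 \<and> j < DIM('a) then (\<nu> (e 1) (e j) \<bullet> e (Suc j)) *\<^sub>R e (Suc j) else 0) \<bullet> e k"
      using 0 * by (cases "i = 1 \<and> k = Suc j") (auto simp: enum_inner[OF e])
  qed
  then show ?thesis by (rule that)
qed

text \<open>The straight segment from the identity to the given operator has positive diagonal
  entries throughout, so it is a connected set inside the centralizer.\<close>

lemma diag_op_in_torus_group:
  assumes "\<And>i. i \<in> {1..DIM('a)} \<Longrightarrow> d i > 0"
  shows "diag_op e d \<in> torus_group (L_torus e)"
proof -
  let ?p = "\<lambda>t. diag_op e (\<lambda>i. (1 - t) + t * d i)"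
  have pos: "(1 - t) + t * d i > 0" if "t \<in> {0..1}" "i \<in> {1..DIM('a)}" for t i
  proof (cases "t = 1")
    case False
    then have "1 - t > 0" "t * d i \<ge> 0" using that assms[of i] by auto
    then show ?thesis by simp
  qed (use that assms in simp)
  have "continuous_on {0..1} ?p"
  proof (rule continuous_on_coordinatewise_then_product)
    show "continuous_on {0..1} (\<lambda>t. ?p t x)" for x
      unfolding diag_op_def by (intro continuous_intros)
  qed
  then have "connected (?p ` {0..1})" by (rule connected_continuous_image) simp
  moreover have "id \<in> ?p ` {0..1}"
    by (rule image_eqI[of _ _ 0]) (simp_all add: diag_op_one)
  moreover have "?p ` {0..1} \<subseteq> centralizer_GL (L_torus e)"
  proof
    fix g assume "g \<in> ?p ` {0..1}"
    then obtain t where t: "t \<in> {0..1}" "g = ?p t" by blast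
    have "bij g" unfolding t(2) using pos[OF t(1)] by (intro inv_diag_op(1)) force
    moreover have "diag_op e c \<circ> diag_op e c' = diag_op e c' \<circ> diag_op e c" for c c'
      by (simp add: fun_eq_iff diag_op_comp mult.commute)
    ultimately show "g \<in> centralizer_GL (L_torus e)"
      using t(2) by (auto simp: centralizer_GL_def GL_def gl_def linear_diag_op L_torus_def L_diag_def)
  qed
  ultimately have "?p ` {0..1} \<subseteq> torus_group (L_torus e)"
    unfolding torus_group_def by (intro connected_component_maximal)
  moreover have "diag_op e d \<in> ?p ` {0..1}"
    by (rule image_eqI[of _ _ 1]) simp_all
  ultimately show ?thesis by blast
qed

lemma filiform_in_orbit_closure:
  assumes a: "\<And>j. a j > 0"
  obtains \<nu> where "\<nu> \<in> orbit_closure (L_bracket e) (L_torus e)" "filiform_bracket a \<nu>"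
proof -
  \<comment> \<open>These partial products solve d_{j+1} / (d_1 d_j) = a_j for
    \<open>j \<ge> 2\<close>, with d_1 = 1 as an empty product. The required bracket thus lies in
    the orbit itself.\<close>
  let ?d = "\<lambda>i. \<Prod>k = 2..<i. a k"
  let ?\<nu> = "GL_act (diag_op e ?d) (L_bracket e)"
  have d: "?d i > 0" for i using a by (simp add: prod_pos)
  have nz: "?d i \<noteq> 0" for i using d[of i] by (rule less_imp_neq[symmetric])
  have f: "filiform_bracket (\<lambda>j. ?d (Suc j) / (?d 1 * ?d j)) ?\<nu>"
    by (rule GL_act_L_bracket_filiform) (rule nz)
  have "?d (Suc j) / (?d 1 * ?d j) = a j" if "2 \<le> j" for j
    using that nz[of j] by simp
  then have "filiform_bracket a ?\<nu>" using f unfolding filiform_bracket_def by auto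
  moreover have "?\<nu> \<in> orbit_closure (L_bracket e) (L_torus e)"
    unfolding orbit_closure_def
  proof
    show "?\<nu> \<in> closure ((\<lambda>g. GL_act g (L_bracket e)) ` torus_group (L_torus e))"
      by (intro subsetD[OF closure_subset] imageI diag_op_in_torus_group d)
    show "?\<nu> \<in> brackets" using f by (simp add: filiform_bracket_def)
  qed
  ultimately show ?thesis using that by blast
qed

section \<open>The cone in terms of root combinations\<close>

lemma diag_op_in_L_coneE:
  assumes "diag_op e c \<in> L_cone e"
  obtains b where "\<And>j. b j \<ge> 0"
    "\<And>i. i \<in> {1..DIM('a)} \<Longrightarrow> root_comb DIM('a) b i < c i"
proof -
  obtain r \<nu> p where r: "r > 0" and \<nu>: "\<nu> \<in> orbit_closure (L_bracket e) (L_torus e)"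
    and p: "\<And>i. i \<in> {1..DIM('a)} \<Longrightarrow> p i > 0"
    and D: "diag_op e c = (\<lambda>x. r *\<^sub>R moment_map e \<nu> x + diag_op e p x)"
    using assms unfolding L_cone_def cone_C_def Diag_pos_def by blast
  obtain a where a: "filiform_bracket a \<nu>" using orbit_closure_filiform[OF \<nu>] .
  define s where "s = 1 / (\<Sum>k = 2..<DIM('a). (a k)\<^sup>2)"
  have s: "s \<ge> 0" by (simp add: s_def sum_nonneg)
  show ?thesis
  proof (rule that)
    \<comment> \<open>The weights absorb both the cone factor \<open>r\<close> and the normalization
      \<open>s\<close> of the moment map.\<close>
    show "r * (s * (a j)\<^sup>2) \<ge> 0" for j using r s by simp
    fix i assume i: "i \<in> {1..DIM('a)}"
    have "diag_op e c (e i) \<bullet> e i = (r *\<^sub>R moment_map e \<nu> (e i) + diag_op e p (e i)) \<bullet> e i"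
      using fun_cong[OF D] by simp
    then have "c i = root_comb DIM('a) (\<lambda>j. r * (s * (a j)\<^sup>2)) i + p i"
      using i enum_inner[OF e i i]
      by (simp add: moment_map_filiform[OF a] s_def[symmetric] diag_op_inner inner_add_left
          root_comb_cmult[of _ r])
    then show "root_comb DIM('a) (\<lambda>j. r * (s * (a j)\<^sup>2)) i < c i" using p[OF i] by simp
  qed
qed

lemma diag_op_in_L_coneI:
  assumes T: "diag_op e c \<in> L_torus e" and tr: "(\<Sum>i = 1..DIM('a). c i) > 0"
    and dim: "DIM('a) \<ge> 3"
    and b: "\<And>j. j \<in> {2..<DIM('a)} \<Longrightarrow> b j > 0"
    and less: "\<And>i. i \<in> {1..DIM('a)} \<Longrightarrow> root_comb DIM('a) b i < c i"
  shows "diag_op e c \<in> L_cone e"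
proof -
  \<comment> \<open>With a_j^2 = b_j the moment map has weights b_j divided by their sum; scaling by
    that sum restores \<open>b\<close>. Outside the index range, \<open>a\<close> is set to 1
    because \<open>filiform_in_orbit_closure\<close> asks for positivity everywhere.\<close>
  let ?r = "\<Sum>j = 2..<DIM('a). b j"
  define a where "a j = (if j \<in> {2..<DIM('a)} then sqrt (b j) else 1)" for j
  have a_pos: "a j > 0" for j using b by (auto simp: a_def)
  then obtain \<nu> where \<nu>: "\<nu> \<in> orbit_closure (L_bracket e) (L_torus e)" "filiform_bracket a \<nu>"
    using filiform_in_orbit_closure by blast
  have a2: "(a j)\<^sup>2 = b j" if "j \<in> {2..<DIM('a)}" for j using that b[of j] by (simp add: a_def)
  then have sum: "(\<Sum>k = 2..<DIM('a). (a k)\<^sup>2) = ?r" by (intro sum.cong) auto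
  have r: "?r > 0" using b dim by (intro sum_pos) auto
  have nz: "\<nu> \<noteq> (\<lambda>x y. 0)"
    using filiform_bracket_nonzero[OF \<nu>(2), of 2] a_pos[of 2] dim by simp
  have m: "moment_map e \<nu> = diag_op e (root_comb DIM('a) (\<lambda>j. 1 / ?r * b j))"
    unfolding moment_map_filiform[OF \<nu>(2)] sum
    using a2 by (intro diag_op_cong) (simp add: root_comb_def)
  let ?E = "diag_op e (\<lambda>i. c i - root_comb DIM('a) b i)"
  have "diag_op e c = (\<lambda>x. ?r *\<^sub>R moment_map e \<nu> x + ?E x)"
    using r unfolding m root_comb_cmult
    by (intro ext enum_eqI) (simp add: diag_op_inner inner_add_left algebra_simps)
  moreover have "?E \<in> Diag_pos e" using less by (auto simp: Diag_pos_def intro!: exI)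
  moreover have "op_trace e (diag_op e c) = (\<Sum>i = 1..DIM('a). c i)"
    unfolding op_trace_def by (intro sum.cong) (simp_all add: diag_op_inner enum_inner[OF e])
  moreover have "moment_map e \<nu> \<in> Diag e" by (simp add: m Diag_def)
  ultimately show ?thesis
    unfolding L_cone_def cone_C_def using T tr r \<nu>(1) nz by auto
qed

end

section \<open>Weights for the arithmetic progression\<close>

lemma sum_arith_progression_from_2:
  assumes "1 \<le> n"
  shows "(\<Sum>i = 2..n. (real i - 2) * d1 + d2) = (real n - 1) * (real n - 2) / 2 * d1 + (real n - 1) * d2"
  using assms
proof (induction n rule: dec_induct)
  case (step m)
  then have "{2..Suc m} = insert (Suc m) {2..m}" by auto
  then show ?case using step.IH by (simp add: field_simps)
qed simp

text \<open>With tail sums as weights, consecutive differences leave exactly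
  \<open>\<epsilon>\<close> at every entry from 3 on. Entries 1 and 2 are checked
  separately.\<close>

lemma arith_progression_weights:
  fixes n :: nat and d1 d2 :: real
  defines "c \<equiv> \<lambda>i. if i = 1 then d1 else (real i - 2) * d1 + d2"
  assumes n: "n \<ge> 4" and P: "(real n - 2) * d1 + d2 > 0" and Q: "(real n - 2) / 2 * d1 + d2 > 0"
  obtains b where "\<And>j. j \<in> {2..<n} \<Longrightarrow> b j > 0" "\<And>i. i \<in> {1..n} \<Longrightarrow> root_comb n b i < c i"
proof -
  define p where "p = (real n - 2) * d1 + d2"
  define q where "q = (real n - 2) / 2 * d1 + d2"
  \<comment> \<open>Here \<open>p\<close> is the last entry and \<open>q\<close> the mean of entries
    2 to \<open>n\<close>; the decrement must stay below both.\<close>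
  define \<epsilon> where "\<epsilon> = min p q / 2"
  have eps: "\<epsilon> > 0" "\<epsilon> < p" "\<epsilon> < q" using P Q unfolding p_def[symmetric] q_def[symmetric] by (auto simp: \<epsilon>_def)
  \<comment> \<open>\<open>b j\<close> is the tail sum of \<open>c i - \<epsilon>\<close> over \<open>i > j\<close>.\<close>
  define b where "b j = (real n - real j) * ((real j + real n - 3) / 2 * d1 + d2 - \<epsilon>)" for j
  have b_pos: "b j > 0" if j: "j \<in> {2..<n}" for j
  proof -
    \<comment> \<open>Up to \<open>\<epsilon>\<close> this is the mean of the entries after
      \<open>j\<close>. It is at least \<open>q\<close> if the progression is nondecreasing, and at
      least its last entry \<open>p\<close> if it is decreasing.\<close>
    have "(real j + real n - 3) / 2 * d1 + d2 - \<epsilon> > 0"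
    proof (cases "d1 \<ge> 0")
      case True
      then have "(real j + real n - 3) / 2 * d1 \<ge> (real n - 2) / 2 * d1"
        using j by (intro mult_right_mono) auto
      then show ?thesis using eps by (simp add: q_def)
    next
      case False
      have "real j \<le> real n - 1" using j by auto
      then have "(real j + real n - 3) / 2 * d1 \<ge> (real n - 2) * d1"
        using False by (intro mult_right_mono_neg) auto
      then show ?thesis using eps by (simp add: p_def)
    qed
    then show ?thesis unfolding b_def using j by simp
  qed
  have first: "root_comb n b 1 < c 1"
  proof -
    have "(\<Sum>j = 2..<n. b j) \<ge> b 2"
      using n b_pos by (intro member_le_sum) (auto intro: less_imp_le)
    moreover have "b 2 + d1 > 0"
    proof (cases "d1 \<ge> 0")
      case True
      then show ?thesis using b_pos[of 2] n by simp
    next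
      case False
      \<comment> \<open>Expressing \<open>b 2\<close> through \<open>p\<close> isolates a
        nonnegative multiple of \<open>- d1\<close>. Its coefficient is zero at
        \<open>n = 4\<close>, the smallest dimension allowed.\<close>
      have "b 2 + d1 = (real n - 2) * (p - \<epsilon>) + ((real n - 2) * (real n - 3) / 2 - 1) * (- d1)"
        by (simp add: b_def p_def field_simps)
      moreover have "(real n - 2) * (p - \<epsilon>) > 0" using eps n by simp
      moreover have "(real n - 2) * (real n - 3) \<ge> 2 * 1" using n by (intro mult_mono) auto
      then have "((real n - 2) * (real n - 3) / 2 - 1) * (- d1) \<ge> 0"
        using False by (intro mult_nonneg_nonneg) auto
      ultimately show ?thesis by linarith
    qed
    ultimately show ?thesis by (simp add: root_comb_1[simplified] c_def)
  qed
  have rest: "root_comb n b i < c i" if i: "i \<in> {2..n}" for i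
  proof -
    consider "i = 2" | "3 \<le> i" "i < n" | "i = n" using i by fastforce
    then show ?thesis
    proof cases
      case 1
      have "d2 + b 2 = (real n - 1) * q - (real n - 2) * \<epsilon>"
        by (simp add: b_def q_def field_simps)
      moreover have "(real n - 2) * \<epsilon> < (real n - 1) * q"
        using eps n by (intro mult_strict_mono) auto
      ultimately show ?thesis using 1 n by (simp add: root_comb_ge_2 c_def)
    next
      case 2
      then have "c i - (b (i - 1) - b i) = \<epsilon>"
        by (simp add: b_def c_def of_nat_diff field_simps)
      then show ?thesis using 2 eps by (simp add: root_comb_ge_2)
    next
      case 3
      then have "c i - b (i - 1) = \<epsilon>"
        using n by (simp add: b_def c_def of_nat_diff field_simps)
      then show ?thesis using 3 eps n by (simp add: root_comb_ge_2)
    qed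
  qed
  show ?thesis
  proof (rule that)
    show "root_comb n b i < c i" if "i \<in> {1..n}" for i
      using first rest[of i] that by (cases "i = 1") auto
  qed (rule b_pos)
qed

theorem proposition1p5:
  fixes e :: "nat \<Rightarrow> 'a::euclidean_space" and n :: nat and d1 d2 :: real
  assumes "n = DIM('a)" and "n \<ge> 4" and "bij_betw e {1..n} (Basis :: 'a set)"
  shows "L_diag e d1 d2 \<in> L_cone e \<longleftrightarrow>
    (real n - 2) * d1 + d2 > 0 \<and>
    (real n - 1) * (real n - 2) / 2 * d1 + (real n - 1) * d2 > 0"
proof -
  define c where "c = (\<lambda>i. if i = 1 then d1 else (real i - 2) * d1 + d2)"
  have D: "L_diag e d1 d2 = diag_op e c" by (simp add: L_diag_def c_def)
  have e: "bij_betw e {1..DIM('a)} Basis" using assms by simp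
  have sum_c: "(\<Sum>i = 2..n. c i) = (real n - 1) * (real n - 2) / 2 * d1 + (real n - 1) * d2"
    using sum_arith_progression_from_2[of n d1 d2] assms(2) by (simp add: c_def)
  have ins: "{1..n} = insert 1 {2..n}" using assms(2) by auto
  show ?thesis unfolding D
  proof
    assume "diag_op e c \<in> L_cone e"
    then obtain b where b: "\<And>j. b j \<ge> 0" "\<And>i. i \<in> {1..n} \<Longrightarrow> root_comb n b i < c i"
      using diag_op_in_L_coneE[OF e] assms(1) by metis
    \<comment> \<open>Entry \<open>n\<close> meets only the root ending in e_n, so its combination
      is \<open>b (n - 1)\<close>, which is nonnegative.\<close>
    have "root_comb n b n < c n" using b(2)[of n] assms(2) by simp
    then have "c n > 0" using b(1)[of "n - 1"] assms(2) by (simp add: root_comb_ge_2)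
    \<comment> \<open>Weighting by the indicator of \<open>i \<noteq> 1\<close> brings in
      \<open>sum_root_comb\<close>: each root then contributes 1 - 0 - 1 = 0.\<close>
    moreover have "(\<Sum>i = 2..n. root_comb n b i) = (\<Sum>i = 1..n. root_comb n b i * of_bool (i \<noteq> 1))"
      unfolding ins by (simp, intro sum.cong) auto
    then have "(\<Sum>i = 2..n. root_comb n b i) = 0"
      unfolding sum_root_comb by simp
    then have "(\<Sum>i = 2..n. c i) > 0"
      using sum_strict_mono[of "{2..n}" "root_comb n b" c] b(2) assms(2) by auto
    ultimately show "(real n - 2) * d1 + d2 > 0 \<and>
        (real n - 1) * (real n - 2) / 2 * d1 + (real n - 1) * d2 > 0"
      using assms(2) unfolding sum_c by (simp add: c_def)
  next
    assume *: "(real n - 2) * d1 + d2 > 0 \<and>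
        (real n - 1) * (real n - 2) / 2 * d1 + (real n - 1) * d2 > 0"
    then have "(real n - 1) * ((real n - 2) / 2 * d1 + d2) > 0" by (simp add: field_simps)
    then have Q: "(real n - 2) / 2 * d1 + d2 > 0" using assms(2) by (simp add: zero_less_mult_iff)
    \<comment> \<open>The trace condition of the cone follows from the two inequalities. For
      \<open>d1 < 0\<close>, comparing entries 2 to \<open>n\<close> with the smallest of them, the
      last, leaves enough to compensate for the first entry \<open>d1\<close>.\<close>
    have tr: "(\<Sum>i = 1..n. c i) > 0"
    proof (cases "d1 \<ge> 0")
      case True
      then show ?thesis unfolding ins using * sum_c by (simp add: c_def)
    next
      case False
      have "(\<Sum>i = 1..n. c i) =
        (real n - 1) * ((real n - 2) * d1 + d2) + ((real n - 1) * (real n - 2) / 2 - 1) * (- d1)"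
        unfolding ins using sum_c by (simp add: c_def field_simps)
      moreover have "(real n - 1) * ((real n - 2) * d1 + d2) > 0"
        using * assms(2) by (intro mult_pos_pos) auto
      moreover have "(real n - 1) * (real n - 2) \<ge> 2 * 1"
        using assms(2) by (intro mult_mono) auto
      then have "((real n - 1) * (real n - 2) / 2 - 1) * (- d1) \<ge> 0"
        using False by (intro mult_nonneg_nonneg) auto
      ultimately show ?thesis by linarith
    qed
    obtain b where b: "\<And>j. j \<in> {2..<n} \<Longrightarrow> b j > 0" "\<And>i. i \<in> {1..n} \<Longrightarrow> root_comb n b i < c i"
      using arith_progression_weights[OF assms(2) _ Q] * unfolding c_def by blast
    have "diag_op e c \<in> L_torus e" unfolding D[symmetric] L_torus_def by blast
    then show "diag_op e c \<in> L_cone e"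
      using b tr assms(1,2) by (intro diag_op_in_L_coneI[OF e, of c b]) auto
  qed
qed

end
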